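(* Let $x\in\mathbb{Q}\cap[0,1]$ have finite even continued fraction expansion $x=[(e_1,a_1),(e_2,a_2),\ldots,(e_n,a_n)]$ (with $n\ge 1$ and $e_1=1$). Then $$Q_E(x)=-\sum_{k=1}^{n}\frac{w_k\,(-e_1)(-e_2)\cdots(-e_k)}{3^{\sum_{i=1}^{k}\lfloor a_i/2\rfloor}},$$ where $w_k=2$ if $a_k$ is even and $w_k=1$ if $a_k=1$.
   Context: Even continued fractions (ECF). Write $$[(e_1,a_1),(e_2,a_2),\ldots,(e_n,a_n)]=\cfrac{e_1}{a_1+\cfrac{e_2}{a_2+\cdots+\cfrac{e_n}{a_n}}}.$$ A finite ECF expansion has $e_i\in\{\pm1\}$ and every $a_i$ a positive even integer, except that the last partial quotient $a_n$ is also allowed to equal $1$ provided $e_n=1$. For numbers in $(0,1]$ one has $e_1=1$. With this convention every rational in $(0,1]$ has a unique finite ECF expansion (e.g. $1=[(1,1)]$, $\frac1{2k}=[(1,2k)]$, $\frac{1}{2k+1}=[(1,2k),(1,1)]$, $\frac38=[(1,2),(1,2),(-1,2)]$); $0$ has the empty expansion. For $k\ge 0$ let $\mathcal{Y}_k$ be the set of rationals in $[0,1]$ whose finite ECF expansion satisfies $a_1+\cdots+a_n\le 2k+1$ (in particular $0,1\in\mathcal{Y}_k$); it has $3^k+1$ elements. For $x\in\mathcal{Y}_k$ define $$Q_E(x)=\frac{|\{y\in\mathcal{Y}_k: y<x\}|}{3^k};$$ this does not depend on the choice of $k$ with $x\in\mathcal{Y}_k$, so $Q_E$ is defined on $\mathbb{Q}\cap[0,1]$.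 *)

theory Defs
  imports Complex_Main
begin

text \<open>
  A finite continued fraction is represented by the list of its pairs
  (sign, partial quotient), outermost pair first.
\<close>

fun cf_value :: "(int \<times> nat) list \<Rightarrow> real" where
  "cf_value [] = 0"
| "cf_value ((e, a) # c) = of_int e / (of_nat a + cf_value c)"

definition is_ecf :: "(int \<times> nat) list \<Rightarrow> bool" where
  "is_ecf c \<longleftrightarrow> (\<forall>i<length c.
     fst (c ! i) \<in> {1, -1} \<and>
     (snd (c ! i) > 0 \<and> even (snd (c ! i)) \<or>
      Suc i = length c \<and> snd (c ! i) = 1 \<and> fst (c ! i) = 1))"

definition ecf_expansion :: "real \<Rightarrow> (int \<times> nat) list \<Rightarrow> bool" where
  "ecf_expansion x c \<longleftrightarrow> is_ecf c \<and> cf_value c = x"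

text \<open>
  Finite expansions are unique, so the existential quantifier below refers to
  the expansion of \<open>x\<close>. A leading sign \<open>-1\<close> gives a negative value and is
  therefore excluded by \<open>x \<in> {0..1}\<close>.
\<close>

definition Y :: "nat \<Rightarrow> real set" where
  "Y k = {x \<in> \<rat> \<inter> {0..1}.
     \<exists>c. ecf_expansion x c \<and> sum_list (map snd c) \<le> 2 * k + 1}"

text \<open>
  The description is proper for \<open>x \<in> \<rat> \<inter> {0..1}\<close> exactly because the quotient
  does not depend on the choice of \<open>k\<close> with \<open>x \<in> Y k\<close>.
\<close>

definition Q_E :: "real \<Rightarrow> real" where
  "Q_E x = (THE q. \<exists>k. x \<in> Y k \<and> q = of_nat (card {y \<in> Y k. y < x}) / 3 ^ k)"

end

theory Submission
  imports Defs
begin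

text \<open>
  The sum in the theorem unfolds along the expansion. Its value \<open>F\<close> (\<open>ecf_rank\<close>) satisfies
  \<open>F ((e, 2 * j) # c) = e * (2 - F c) / 3 ^ j\<close>, next to
  \<open>cf_value ((e, 2 * j) # c) = e / (2 * j + cf_value c)\<close>. The two recursions have the
  same order structure. In both, the tail contributes a number of \<open>(- 1, 1]\<close> and the
  result decreases with it when \<open>e = 1\<close> and increases when \<open>e = - 1\<close>; as the tail varies, the absolute value of
  the result stays in an interval determined by \<open>j\<close>, namely \<open>[1 / (2 * j + 1), 1 / (2 * j - 1))\<close>
  for the continued fraction and \<open>[3 / 3 ^ (j + 1), 3 / 3 ^ j)\<close> for \<open>F\<close>. These intervals are
  disjoint and move towards \<open>0\<close> as \<open>j\<close> grows. Hence \<open>F\<close> is a strictly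
  increasing function of the value of the expansion (\<open>sgn_ecf_rank_diff\<close>).

  Moreover \<open>3 ^ k * F\<close> takes exactly the integers of \<open>(- 3 ^ k, 3 ^ k]\<close> as values on the
  expansions of either leading sign whose partial quotients sum to at most \<open>2 * k + 1\<close>
  (\<open>ecf_rank_in_Ints\<close>, \<open>ecf_rank_surj\<close>).
  So the elements of \<open>Y k\<close> below \<open>x\<close> correspond, in order, to the integers of
  \<open>[0, 3 ^ k * F)\<close>, and their number divided by \<open>3 ^ k\<close> is \<open>F\<close>, for every admissible \<open>k\<close>.
\<close>

section \<open>Finite even continued fractions\<close>

lemma is_ecf_Nil [simp]: "is_ecf []"
  by (simp add: is_ecf_def)

lemma is_ecf_Cons:
  "is_ecf ((e, a) # c) \<longleftrightarrow>
    e \<in> {1, - 1} \<and> (a > 0 \<and> even a \<or> c = [] \<and> a = 1 \<and> e = 1) \<and> is_ecf c"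
  unfolding is_ecf_def by (auto simp: All_less_Suc2)

text \<open>
  The only partial quotient \<open>1\<close> is that of the expansion \<open>[(1, 1)]\<close> of \<open>1\<close>, which can therefore
  be treated as a second base case.
\<close>

lemma is_ecf_cases [consumes 1, case_names Nil one even]:
  assumes "is_ecf c"
  obtains "c = []"
  | "c = [(1, 1)]"
  | e j d where "c = (e, 2 * j) # d" "e = 1 \<or> e = - 1" "j \<ge> 1" "is_ecf d"
proof (cases c)
  case Nil
  then show ?thesis by (rule that(1))
next
  case (Cons p d)
  obtain e a where p: "p = (e, a)" by (cases p)
  from assms have *: "e = 1 \<or> e = - 1" "a > 0 \<and> even a \<or> d = [] \<and> a = 1 \<and> e = 1" "is_ecf d"
    by (auto simp: Cons p is_ecf_Cons)
  from *(2) show ?thesis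
  proof
    assume a: "a > 0 \<and> even a"
    then obtain j where "a = 2 * j" by (auto elim: evenE)
    with a * show ?thesis using that(3)[of e j d] by (simp add: Cons p)
  next
    assume "d = [] \<and> a = 1 \<and> e = 1"
    then show ?thesis using that(2) by (simp add: Cons p)
  qed
qed

lemma is_ecf_induct [consumes 1, case_names Nil one even]:
  assumes "is_ecf c"
    and "P []"
    and "P [(1, 1)]"
    and "\<And>e j c. e = 1 \<or> e = - 1 \<Longrightarrow> j \<ge> 1 \<Longrightarrow> is_ecf c \<Longrightarrow> P c \<Longrightarrow> P ((e, 2 * j) # c)"
  shows "P c"
  using assms(1)
proof (induction c rule: length_induct)
  case (1 c)
  from \<open>is_ecf c\<close> show ?case
    by (cases rule: is_ecf_cases) (use 1 assms in auto)
qed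

lemma cf_value_bounds:
  assumes "is_ecf c"
  shows "- 1 < cf_value c" "cf_value c \<le> 1"
  using assms
proof (induction rule: is_ecf_induct)
  case (even e j c)
  {
    case 1
    from even have "real (2 * j) + cf_value c > 1" by simp
    with even(1) show ?case by (auto simp: field_simps)
  next
    case 2
    from even have "real (2 * j) + cf_value c > 1" by simp
    with even(1) show ?case by (auto simp: field_simps)
  }
qed auto

lemma cf_value_in_Rats: "cf_value c \<in> \<rat>"
  by (induction c rule: cf_value.induct) auto


section \<open>The ternary sum as a recursion\<close>

fun ecf_rank :: "(int \<times> nat) list \<Rightarrow> real" where
  "ecf_rank [] = 0"
| "ecf_rank ((e, a) # c) = of_int e * ((if even a then 2 else 1) - ecf_rank c) / 3 ^ (a div 2)"

lemma ecf_rank_eq_sum: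
  "ecf_rank c =
    - (\<Sum>k<length c.
         (if even (snd (c ! k)) then 2 else 1) * (\<Prod>i\<le>k. - of_int (fst (c ! i)))
         / 3 ^ (\<Sum>i\<le>k. snd (c ! i) div 2))"
proof (induction c rule: ecf_rank.induct)
  case (2 e a c)
  have "(\<Sum>k<length ((e, a) # c).
         (if even (snd (((e, a) # c) ! k)) then 2 else 1)
           * (\<Prod>i\<le>k. - of_int (fst (((e, a) # c) ! i)))
         / 3 ^ (\<Sum>i\<le>k. snd (((e, a) # c) ! i) div 2)) =
      (if even a then 2 else 1) * (- of_int e) / 3 ^ (a div 2)
      + (\<Sum>k<length c. (- of_int e / 3 ^ (a div 2)) *
         ((if even (snd (c ! k)) then 2 else 1) * (\<Prod>i\<le>k. - of_int (fst (c ! i)))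
         / (3 ^ (\<Sum>i\<le>k. snd (c ! i) div 2) :: real)))"
    unfolding length_Cons sum.lessThan_Suc_shift
    by (intro arg_cong2[where f = "(+)"] sum.cong refl)
      (simp_all add: sum.atMost_Suc_shift prod.atMost_Suc_shift power_add
        del: sum.atMost_Suc prod.atMost_Suc)
  then show ?case
    unfolding ecf_rank.simps 2 sum_distrib_left[symmetric]
    by (simp only:) (simp add: add_divide_distrib diff_divide_distrib algebra_simps)
qed simp

lemma ecf_rank_bounds:
  assumes "is_ecf c"
  shows "- 1 < ecf_rank c" "ecf_rank c \<le> 1"
  using assms
proof (induction rule: is_ecf_induct)
  case (even e j c)
  obtain R where R: "ecf_rank ((e, 2 * j) # c) = of_int e * R" "0 < R" "R < 1"
  proof (rule that)
    show "ecf_rank ((e, 2 * j) # c) = of_int e * ((2 - ecf_rank c) / 3 ^ j)" by simp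
    have "(3 :: real) ^ 1 \<le> 3 ^ j"
      using even by (intro power_increasing) auto
    with even show "0 < (2 - ecf_rank c) / 3 ^ j" "(2 - ecf_rank c) / 3 ^ j < 1" by simp_all
  qed
  show "- 1 < ecf_rank ((e, 2 * j) # c)" "ecf_rank ((e, 2 * j) # c) \<le> 1"
    unfolding R(1) using even(1) R(2,3) by auto
qed auto


section \<open>Monotonicity\<close>

text \<open>
  Different first quotients give values in disjoint intervals: the worst cases are the bounds
  \<open>1\<close> and \<open>- 1\<close> of the tails, where \<open>2 * j + 1 = 2 * (j + 1) - 1\<close> and
  \<open>1 / 3 ^ j = 3 / 3 ^ (j + 1)\<close>.
\<close>

lemma first_quotient_separates:
  fixes v w p q :: real
  assumes "1 \<le> j" "j < i" "- 1 < v" "v \<le> 1" "- 1 < w" "p \<le> 1" "- 1 < q"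
  shows "1 / (real (2 * i) + w) < 1 / (real (2 * j) + v)"
    and "(2 - q) / 3 ^ i < (2 - p) / 3 ^ j"
proof -
  have "real j \<ge> 1" "real i \<ge> real j + 1" using assms by auto
  with assms show "1 / (real (2 * i) + w) < 1 / (real (2 * j) + v)"
    by (intro divide_strict_left_mono) auto
  have "(3 :: real) ^ Suc j \<le> 3 ^ i"
    using assms by (intro power_increasing) auto
  then have "3 / 3 ^ i \<le> 1 / (3 :: real) ^ j" by (simp add: field_simps)
  moreover have "(2 - q) / 3 ^ i < 3 / 3 ^ i"
    using assms by (intro divide_strict_right_mono) auto
  moreover have "1 / 3 ^ j \<le> (2 - p) / 3 ^ j"
    using assms by (intro divide_right_mono) auto
  ultimately show "(2 - q) / 3 ^ i < (2 - p) / 3 ^ j" by linarith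
qed

lemma sgn_diff_step:
  fixes v w p q :: real
  assumes "1 \<le> j" "1 \<le> i"
    and "- 1 < v" "v \<le> 1" "- 1 < w" "w \<le> 1"
    and "- 1 < p" "p \<le> 1" "- 1 < q" "q \<le> 1"
    and "sgn (p - q) = sgn (v - w)"
  shows "sgn ((2 - p) / 3 ^ j - (2 - q) / 3 ^ i) =
    sgn (1 / (real (2 * j) + v) - 1 / (real (2 * i) + w))"
proof (cases j i rule: linorder_cases)
  case less
  then show ?thesis
    using first_quotient_separates[of j i v w p q] assms by simp
next
  case greater
  then show ?thesis
    using first_quotient_separates[of i j w v q p] assms by simp
next
  case equal
  have pos: "real (2 * i) + v > 0" "real (2 * i) + w > 0" using assms by auto
  have "(2 - p) / 3 ^ i - (2 - q) / 3 ^ i = (q - p) / 3 ^ i"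
    by (simp flip: diff_divide_distrib)
  moreover have "1 / (real (2 * i) + v) - 1 / (real (2 * i) + w) =
      (w - v) / ((real (2 * i) + v) * (real (2 * i) + w))"
    using pos by (simp add: diff_frac_eq)
  moreover have "sgn (q - p) = sgn (w - v)"
    using assms(11) by (metis minus_diff_eq sgn_minus)
  ultimately show ?thesis
    using pos unfolding equal by (simp add: sgn_divide sgn_mult)
qed

lemma first_quotient_abs_bounds:
  assumes "is_ecf c" "1 \<le> j"
  shows "0 < 1 / (real (2 * j) + cf_value c)" "1 / (real (2 * j) + cf_value c) < 1"
    and "0 < (2 - ecf_rank c) / 3 ^ j" "(2 - ecf_rank c) / 3 ^ j < 1"
proof -
  have "real (2 * j) + cf_value c > 1"
    using cf_value_bounds(1)[OF assms(1)] assms(2) by simp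
  then show "0 < 1 / (real (2 * j) + cf_value c)" "1 / (real (2 * j) + cf_value c) < 1"
    by simp_all
  have "(3 :: real) ^ 1 \<le> 3 ^ j"
    using assms(2) by (intro power_increasing) auto
  then show "0 < (2 - ecf_rank c) / 3 ^ j" "(2 - ecf_rank c) / 3 ^ j < 1"
    using ecf_rank_bounds[OF assms(1)] by simp_all
qed

text \<open>
  Signs of differences express that the order of the ranks and the order of the values agree,
  in a form that is symmetric in both expansions. The symmetry matters because passing to the
  tails reverses the order when the leading sign is \<open>1\<close>.
\<close>

lemma sgn_ecf_rank_diff:
  assumes "is_ecf c" "is_ecf d"
  shows "sgn (ecf_rank c - ecf_rank d) = sgn (cf_value c - cf_value d)"
  using assms
proof (induction arbitrary: d rule: is_ecf_induct)
  case Nil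
  from Nil show ?case
  proof (cases rule: is_ecf_cases)
    case (even f i d')
    have "sgn (0 - of_int f * R) = sgn (0 - of_int f * V)" if "0 < V" "0 < R" for V R :: real
      using that even(2) by auto
    from this[OF first_quotient_abs_bounds(1,3)[OF even(4,3)]] show ?thesis
      by (simp add: even(1))
  qed auto
next
  case one
  from one show ?case
  proof (cases rule: is_ecf_cases)
    case (even f i d')
    have "sgn (1 - of_int f * R) = sgn (1 - of_int f * V)" if "0 < V" "V < 1" "0 < R" "R < 1"
      for V R :: real
      using that even(2) by auto
    from this[OF first_quotient_abs_bounds[OF even(4,3)]] show ?thesis
      by (simp add: even(1))
  qed auto
next
  case (even e j c)
  define V R where "V = 1 / (real (2 * j) + cf_value c)" and "R = (2 - ecf_rank c) / 3 ^ j"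
  have VR: "0 < V" "V < 1" "0 < R" "R < 1"
    using first_quotient_abs_bounds[OF even(3,2)] by (simp_all add: V_def R_def)
  have eqs: "cf_value ((e, 2 * j) # c) = of_int e * V" "ecf_rank ((e, 2 * j) # c) = of_int e * R"
    by (simp_all add: V_def R_def)
  from even.prems show ?case
  proof (cases rule: is_ecf_cases)
    case Nil
    then show ?thesis using VR by (simp add: eqs sgn_mult del: cf_value.simps(2) ecf_rank.simps(2))
  next
    case one
    have "of_int e * V < 1" "of_int e * R < 1" using VR even(1) by auto
    with one eqs show ?thesis by simp
  next
    case d: (even f i d')
    define V' R' where "V' = 1 / (real (2 * i) + cf_value d')" and "R' = (2 - ecf_rank d') / 3 ^ i"
    have VR': "0 < V'" "V' < 1" "0 < R'" "R' < 1"
      using first_quotient_abs_bounds[OF d(4,3)] by (simp_all add: V'_def R'_def)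
    have eqs': "cf_value d = of_int f * V'" "ecf_rank d = of_int f * R'"
      by (simp_all add: V'_def R'_def d(1))
    have "sgn (of_int e * R - of_int f * R') = sgn (of_int e * V - of_int f * V')"
    proof (cases "e = f")
      case True
      have "sgn (R - R') = sgn (V - V')"
        unfolding V_def R_def V'_def R'_def
        by (rule sgn_diff_step) (use even d cf_value_bounds ecf_rank_bounds in auto)
      then show ?thesis
        by (simp add: True sgn_mult flip: right_diff_distrib)
    next
      case False
      with even(1) d(2) VR VR' show ?thesis by (auto simp: sgn_if)
    qed
    then show ?thesis by (simp only: eqs eqs')
  qed
qed


section \<open>The values of the rank\<close>

lemma ecf_rank_in_Ints:
  assumes "is_ecf c" "sum_list (map snd c) \<le> 2 * k + 1"
  shows "3 ^ k * ecf_rank c \<in> \<int>"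
  using assms
proof (induction arbitrary: k rule: is_ecf_induct)
  case (even e j c)
  then have "j \<le> k" "sum_list (map snd c) \<le> 2 * (k - j) + 1" by auto
  with even have "3 ^ (k - j) * ecf_rank c \<in> \<int>" by blast
  then have "of_int e * (2 * 3 ^ (k - j) - 3 ^ (k - j) * ecf_rank c) \<in> \<int>" by simp
  also have "of_int e * (2 * 3 ^ (k - j) - 3 ^ (k - j) * ecf_rank c) =
      3 ^ k * ecf_rank ((e, 2 * j) # c)"
    using \<open>j \<le> k\<close> by (simp add: power_diff field_simps)
  finally show ?case .
qed auto

text \<open>
  The first quotient of the wanted expansion is read off from the position of \<open>\<bar>n\<bar>\<close> between
  consecutive powers of \<open>3\<close>; the recursion for the rank then determines the integer to be
  represented by the tail.
\<close>

lemma ecf_rank_surj: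
  fixes n :: int
  assumes "- (3 ^ k) < n" "n \<le> 3 ^ k"
  shows "\<exists>c. is_ecf c \<and> sum_list (map snd c) \<le> 2 * k + 1 \<and> 3 ^ k * ecf_rank c = of_int n"
  using assms
proof (induction k arbitrary: n rule: less_induct)
  case (less k)
  consider "n = 0" | "n = 3 ^ k" | "n \<noteq> 0" "\<bar>n\<bar> < 3 ^ k"
    using less.prems by linarith
  then show ?case
  proof cases
    case 1
    then show ?thesis by (intro exI[of _ "[]"]) simp
  next
    case 2
    then show ?thesis by (intro exI[of _ "[(1, 1)]"]) (simp add: is_ecf_Cons)
  next
    case 3
    \<comment> \<open>The exponent with \<open>3 ^ m \<le> \<bar>n\<bar> < 3 ^ (m + 1)\<close>; the first quotient is \<open>2 * (k - m)\<close>.\<close>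
    define m where "m = (LEAST m. \<bar>n\<bar> < 3 ^ Suc m)"
    have "k \<noteq> 0" using 3 by (intro notI) simp
    then have ex: "\<bar>n\<bar> < 3 ^ Suc (k - 1)" using 3 by simp
    have up: "\<bar>n\<bar> < 3 ^ Suc m"
      unfolding m_def by (rule LeastI[of "\<lambda>m. \<bar>n\<bar> < 3 ^ Suc m", OF ex])
    have "m \<le> k - 1"
      unfolding m_def by (rule Least_le[of "\<lambda>m. \<bar>n\<bar> < 3 ^ Suc m", OF ex])
    with \<open>k \<noteq> 0\<close> have "m < k" by simp
    have low: "3 ^ m \<le> \<bar>n\<bar>"
    proof (cases m)
      case 0
      then show ?thesis using 3 by simp
    next
      case (Suc l)
      then have "\<not> \<bar>n\<bar> < 3 ^ Suc l"
        using not_less_Least[of l "\<lambda>m. \<bar>n\<bar> < 3 ^ Suc m"] by (simp add: m_def)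
      then show ?thesis using Suc by simp
    qed
    have "- (3 ^ m) < 2 * 3 ^ m - \<bar>n\<bar>" "2 * 3 ^ m - \<bar>n\<bar> \<le> 3 ^ m"
      using up low by auto
    from less.IH[OF \<open>m < k\<close> this] obtain c where c: "is_ecf c"
      "sum_list (map snd c) \<le> 2 * m + 1" "3 ^ m * ecf_rank c = of_int (2 * 3 ^ m - \<bar>n\<bar>)"
      by blast
    define j where "j = k - m"
    have k: "k = j + m" "j \<ge> 1" using \<open>m < k\<close> by (auto simp: j_def)
    have "3 ^ k * ecf_rank ((sgn n, 2 * j) # c) =
        of_int (sgn n) * (2 * 3 ^ m - 3 ^ m * ecf_rank c)"
      by (simp add: k power_add field_simps)
    also have "\<dots> = of_int (sgn n * \<bar>n\<bar>)" by (simp add: c(3))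
    also have "sgn n * \<bar>n\<bar> = n" by (simp add: sgn_mult_abs)
    finally have "3 ^ k * ecf_rank ((sgn n, 2 * j) # c) = of_int n" .
    moreover have "is_ecf ((sgn n, 2 * j) # c)"
      using c(1) k(2) 3(1) by (simp add: is_ecf_Cons sgn_if)
    moreover have "sum_list (map snd ((sgn n, 2 * j) # c)) \<le> 2 * k + 1"
      using c(2) k by simp
    ultimately show ?thesis by blast
  qed
qed


section \<open>Counting\<close>

lemma ecf_rank_eq_iff:
  "is_ecf c \<Longrightarrow> is_ecf d \<Longrightarrow> ecf_rank c = ecf_rank d \<longleftrightarrow> cf_value c = cf_value d"
  using sgn_ecf_rank_diff[of c d] by (metis eq_iff_diff_eq_0 sgn_eq_0_iff)

lemma ecf_rank_less_iff:
  assumes "is_ecf c" "is_ecf d"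
  shows "ecf_rank c < ecf_rank d \<longleftrightarrow> cf_value c < cf_value d"
  using sgn_ecf_rank_diff[OF assms] by (auto simp: sgn_if split: if_splits)

lemma ecf_rank_nonneg_iff: "is_ecf c \<Longrightarrow> 0 \<le> ecf_rank c \<longleftrightarrow> 0 \<le> cf_value c"
  using ecf_rank_less_iff[of c "[]"] by auto

lemma card_Y_less:
  assumes "is_ecf c" "0 \<le> cf_value c" "sum_list (map snd c) \<le> 2 * k + 1"
  shows "real (card {y \<in> Y k. y < cf_value c}) = 3 ^ k * ecf_rank c"
proof -
  obtain n where n: "3 ^ k * ecf_rank c = of_int n"
    using ecf_rank_in_Ints[OF assms(1,3)] by (auto elim: Ints_cases)
  have "ecf_rank c \<ge> 0" using assms by (simp add: ecf_rank_nonneg_iff)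
  then have "n \<ge> 0" using n by (metis of_int_0_le_iff zero_le_mult_iff zero_le_numeral zero_le_power)
  have "real_of_int n \<le> 3 ^ k"
    using ecf_rank_bounds(2)[OF assms(1)] by (simp flip: n)
  then have "n \<le> 3 ^ k" by (metis of_int_le_numeral_power_cancel_iff)
  \<comment> \<open>The rank as a function of the value: by monotonicity, expansions of the same number have
    the same rank, so any choice of the expansion will do.\<close>
  define h where "h y = 3 ^ k * ecf_rank (SOME d. ecf_expansion y d)" for y
  have h: "h (cf_value d) = 3 ^ k * ecf_rank d" if "is_ecf d" for d
  proof -
    have "ecf_expansion (cf_value d) (SOME d'. ecf_expansion (cf_value d) d')"
      by (rule someI[of _ d]) (simp add: ecf_expansion_def that)
    then show ?thesis
      using that by (simp add: h_def ecf_expansion_def ecf_rank_eq_iff)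
  qed
  have "bij_betw h {y \<in> Y k. y < cf_value c} (of_int ` {0..<n})"
  proof (rule bij_betw_imageI)
    show "inj_on h {y \<in> Y k. y < cf_value c}"
      by (rule inj_onI) (auto simp: Y_def ecf_expansion_def h ecf_rank_eq_iff)
    show "h ` {y \<in> Y k. y < cf_value c} = of_int ` {0..<n}"
    proof (intro equalityI subsetI)
      fix r assume "r \<in> h ` {y \<in> Y k. y < cf_value c}"
      then obtain d where d: "is_ecf d" "sum_list (map snd d) \<le> 2 * k + 1"
        "0 \<le> cf_value d" "cf_value d < cf_value c" "r = 3 ^ k * ecf_rank d"
        by (auto simp: Y_def ecf_expansion_def h)
      from ecf_rank_in_Ints[OF d(1,2)] obtain m where m: "r = of_int m"
        by (auto simp: d(5) elim: Ints_cases)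
      have "0 \<le> real_of_int m" "real_of_int m < real_of_int n"
        using d assms(1) by (simp_all flip: m n add: ecf_rank_nonneg_iff ecf_rank_less_iff)
      then show "r \<in> of_int ` {0..<n}" by (simp add: m)
    next
      fix r :: real assume "r \<in> of_int ` {0..<n}"
      then obtain m where m: "0 \<le> m" "m < n" "r = of_int m" by auto
      have "- (3 ^ k) < (0 :: int)" by simp
      then have "- (3 ^ k) < m" "m \<le> 3 ^ k" using m \<open>n \<le> 3 ^ k\<close> by linarith+
      from ecf_rank_surj[OF this] obtain d where d: "is_ecf d"
        "sum_list (map snd d) \<le> 2 * k + 1" "3 ^ k * ecf_rank d = of_int m"
        by blast
      have "0 \<le> 3 ^ k * ecf_rank d" "3 ^ k * ecf_rank d < 3 ^ k * ecf_rank c"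
        using m by (simp_all add: d(3) n)
      then have "0 \<le> cf_value d" "cf_value d < cf_value c"
        using d(1) assms(1) by (simp_all add: zero_le_mult_iff power_le_zero_eq ecf_rank_nonneg_iff ecf_rank_less_iff)
      moreover from this have "cf_value d \<in> Y k"
        using d cf_value_bounds[OF d(1)] by (auto simp: Y_def ecf_expansion_def cf_value_in_Rats)
      ultimately show "r \<in> h ` {y \<in> Y k. y < cf_value c}"
        using h[OF d(1)] by (intro image_eqI[of _ _ "cf_value d"]) (simp_all add: d(3) m(3))
    qed
  qed
  then have "card {y \<in> Y k. y < cf_value c} = card ((of_int :: int \<Rightarrow> real) ` {0..<n})"
    by (rule bij_betw_same_card)
  also have "\<dots> = nat n" by (simp add: card_image inj_on_def)
  finally show ?thesis using n \<open>n \<ge> 0\<close> by simp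
qed

theorem theorem1:
  fixes x :: real and c :: "(int \<times> nat) list"
  assumes "x \<in> \<rat> \<inter> {0..1}"
    and "ecf_expansion x c"
    and "length c \<ge> 1"
    and "fst (c ! 0) = 1"
  shows "Q_E x =
    - (\<Sum>k<length c.
         (if even (snd (c ! k)) then 2 else 1) * (\<Prod>i\<le>k. - of_int (fst (c ! i)))
         / 3 ^ (\<Sum>i\<le>k. snd (c ! i) div 2))"
proof -
  have c: "is_ecf c" "x = cf_value c" using assms(2) by (auto simp: ecf_expansion_def)
  have quotient: "of_nat (card {y \<in> Y k. y < x}) / 3 ^ k = ecf_rank c" if "x \<in> Y k" for k
  proof -
    from that obtain d where d: "is_ecf d" "x = cf_value d" "sum_list (map snd d) \<le> 2 * k + 1"
      by (auto simp: Y_def ecf_expansion_def)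
    moreover from d c have "ecf_rank d = ecf_rank c" by (simp add: ecf_rank_eq_iff)
    ultimately show ?thesis using card_Y_less[of d k] assms(1) by simp
  qed
  have "x \<in> Y (sum_list (map snd c))"
    using assms(1,2) by (auto simp: Y_def intro!: exI[of _ c])
  then have "Q_E x = ecf_rank c"
    unfolding Q_E_def by (intro the_equality) (auto simp: quotient)
  then show ?thesis by (simp add: ecf_rank_eq_sum)
qed

end
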